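(* Let $d\ge 1$, let $f^1,\dots,f^d:\mathbb{R}^{2d}\to\mathbb{R}$ be smooth real-valued functions, identify $\mathbb{R}^{2d}\cong\mathbb{C}^d$ via $u^n=x^{2n-1}+i\,x^{2n}$, and let $\Sigma=\{x\in\mathbb{R}^{2d} : f^m(x)=0,\ m=1,\dots,d\}$. Let $M=\left(\frac{\partial f^m}{\partial u^n}\right)_{m,n=1}^d$ and $\bar M=\left(\frac{\partial f^m}{\partial \bar u^n}\right)_{m,n=1}^d$, suppose that $M$ is invertible at every point of $\Sigma$, and on $\Sigma$ put $N=(-1)^d\,\bar M^{-1}M$. Then the $d$-cycle $\Sigma$ is supersymmetric if and only if $N=N^T$ and $\det N=1$ at every point of $\Sigma$.
   Context: The partial derivatives with respect to $u^n$ and $\bar u^n$ are the Wirtinger derivatives $\frac{\partial}{\partial u^n}=\frac12\left(\frac{\partial}{\partial x^{2n-1}}-i\frac{\partial}{\partial x^{2n}}\right)$ and $\frac{\partial}{\partial \bar u^n}=\frac12\left(\frac{\partial}{\partial x^{2n-1}}+i\frac{\partial}{\partial x^{2n}}\right)$. Since the $f^m$ are real-valued, $\bar M$ is the entrywise complex conjugate of $M$. Invertibility of $M$ along $\Sigma$ makes the differentials $df^1,\dots,df^d$ linearly independent along $\Sigma$, so $\Sigma$ is a $d$-dimensional embedded submanifold; write $i:\Sigma\to\mathbb{C}^d$ for the inclusion. A $d$-dimensional submanifold $i:\Sigma\to\mathbb{C}^d$ is called supersymmetric (equivalently, special Lagrangian) if $i^*\omega=0$ and $i^*(\operatorname{Im}\Omega)=0$,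 where $\omega=\frac{1}{2i}\sum_{n=1}^d du^n\wedge d\bar u^n$ (with $i$ the imaginary unit in the prefactor) and $\Omega=du^1\wedge\dots\wedge du^d$. *)

theory Defs
  imports "HOL-Analysis.Analysis"
begin

(* R^(2d) is carried by the real Euclidean space complex ^ 'n with d = CARD('n):
   the coordinate x^(2n-1) is Re (x $ n) and x^(2n) is Im (x $ n), so the corresponding
   coordinate directions are axis n 1 and axis n \<i>. *)

(* Intended for open U; in finite dimension, continuity of all directional
   derivatives is the same as continuity of the derivative. *)
primrec Ck_on :: "nat \<Rightarrow> 'a::euclidean_space set \<Rightarrow> ('a \<Rightarrow> 'b::real_normed_vector) \<Rightarrow> bool" where
  "Ck_on 0 U f \<longleftrightarrow> continuous_on U f"
| "Ck_on (Suc k) U f \<longleftrightarrow>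
     (\<forall>x\<in>U. f differentiable (at x)) \<and>
     (\<forall>v. Ck_on k U (\<lambda>x. frechet_derivative f (at x) v))"

definition smooth_on :: "'a::euclidean_space set \<Rightarrow> ('a \<Rightarrow> 'b::real_normed_vector) \<Rightarrow> bool" where
  "smooth_on U f \<longleftrightarrow> (\<forall>k. Ck_on k U f)"

(* Slice charts: near each of its points S is straightened to a k-dimensional linear
   subspace by a diffeomorphism between open subsets of the ambient space. *)
definition embedded_submanifold :: "nat \<Rightarrow> 'a::euclidean_space set \<Rightarrow> bool" where
  "embedded_submanifold k S \<longleftrightarrow>
     (\<forall>p\<in>S. \<exists>U V \<phi> \<psi> (L :: 'a set).
        open U \<and> p \<in> U \<and> open V \<and> homeomorphism U V \<phi> \<psi> \<and>
        smooth_on U \<phi> \<and> smooth_on V \<psi> \<and>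
        subspace L \<and> dim L = k \<and> \<phi> ` (S \<inter> U) = V \<inter> L)"

definition tangent_space :: "'a::euclidean_space set \<Rightarrow> 'a \<Rightarrow> 'a set" where
  "tangent_space S p =
     {v. \<exists>(\<gamma> :: real \<Rightarrow> 'a) \<epsilon>. \<epsilon> > 0 \<and> smooth_on {-\<epsilon><..<\<epsilon>} \<gamma> \<and> \<gamma> ` {-\<epsilon><..<\<epsilon>} \<subseteq> S \<and>
        \<gamma> 0 = p \<and> (\<gamma> has_vector_derivative v) (at 0)}"

definition partial_deriv :: "('a::real_normed_vector \<Rightarrow> real) \<Rightarrow> 'a \<Rightarrow> 'a \<Rightarrow> real" where
  "partial_deriv f e x = deriv (\<lambda>t::real. f (x + t *\<^sub>R e)) 0"

definition wirtinger :: "(complex ^ 'n \<Rightarrow> real) \<Rightarrow> 'n::finite \<Rightarrow> complex ^ 'n \<Rightarrow> complex" where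
  "wirtinger f n x =
     1/2 * (of_real (partial_deriv f (axis n 1) x) - \<i> * of_real (partial_deriv f (axis n \<i>) x))"

definition wirtinger_bar :: "(complex ^ 'n \<Rightarrow> real) \<Rightarrow> 'n::finite \<Rightarrow> complex ^ 'n \<Rightarrow> complex" where
  "wirtinger_bar f n x =
     1/2 * (of_real (partial_deriv f (axis n 1) x) + \<i> * of_real (partial_deriv f (axis n \<i>) x))"

(* The coefficients of all forms below are constant in x, so the base point is suppressed;
   on a tangent vector v, du^n is v $ n. *)
definition du :: "'n::finite \<Rightarrow> complex ^ 'n \<Rightarrow> complex" where
  "du n v = v $ n"

definition du_bar :: "'n::finite \<Rightarrow> complex ^ 'n \<Rightarrow> complex" where
  "du_bar n v = cnj (v $ n)"

definition wedge2 :: "('v \<Rightarrow> complex) \<Rightarrow> ('v \<Rightarrow> complex) \<Rightarrow> 'v \<Rightarrow> 'v \<Rightarrow> complex" where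
  "wedge2 \<alpha> \<beta> v w = \<alpha> v * \<beta> w - \<alpha> w * \<beta> v"

(* Wedge product of a family of 1-forms.  The forms and the vectors are indexed by the same
   finite type, so the value does not depend on an enumeration of the indices. *)
definition wedge :: "('n::finite \<Rightarrow> 'v \<Rightarrow> complex) \<Rightarrow> ('n \<Rightarrow> 'v) \<Rightarrow> complex" where
  "wedge \<alpha> v = (\<Sum>\<sigma> | \<sigma> permutes UNIV. of_int (sign \<sigma>) * (\<Prod>n\<in>UNIV. \<alpha> n (v (\<sigma> n))))"

definition kahler_form :: "complex ^ 'n::finite \<Rightarrow> complex ^ 'n \<Rightarrow> complex" where
  "kahler_form v w = 1 / (2 * \<i>) * (\<Sum>n\<in>UNIV. wedge2 (du n) (du_bar n) v w)"

definition holomorphic_volume_form :: "('n::finite \<Rightarrow> complex ^ 'n) \<Rightarrow> complex" where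
  "holomorphic_volume_form v = wedge du v"

(* The pullback of a form along the inclusion of S is its restriction to tangent vectors of S. *)
definition supersymmetric :: "(complex ^ 'n::finite) set \<Rightarrow> bool" where
  "supersymmetric S \<longleftrightarrow>
     embedded_submanifold CARD('n) S \<and>
     (\<forall>p\<in>S. \<forall>v\<in>tangent_space S p. \<forall>w\<in>tangent_space S p. kahler_form v w = 0) \<and>
     (\<forall>p\<in>S. \<forall>v. (\<forall>n. v n \<in> tangent_space S p) \<longrightarrow> Im (holomorphic_volume_form v) = 0)"

definition zero_locus :: "('n::finite \<Rightarrow> complex ^ 'n \<Rightarrow> real) \<Rightarrow> (complex ^ 'n) set" where
  "zero_locus f = {x. \<forall>m. f m x = 0}"

definition M_mat :: "('n::finite \<Rightarrow> complex ^ 'n \<Rightarrow> real) \<Rightarrow> complex ^ 'n \<Rightarrow> complex ^ 'n ^ 'n" where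
  "M_mat f x = (\<chi> m n. wirtinger (f m) n x)"

definition Mbar_mat :: "('n::finite \<Rightarrow> complex ^ 'n \<Rightarrow> real) \<Rightarrow> complex ^ 'n \<Rightarrow> complex ^ 'n ^ 'n" where
  "Mbar_mat f x = (\<chi> m n. wirtinger_bar (f m) n x)"

definition N_mat :: "('n::finite \<Rightarrow> complex ^ 'n \<Rightarrow> real) \<Rightarrow> complex ^ 'n \<Rightarrow> complex ^ 'n ^ 'n" where
  "N_mat f x = (-1) ^ CARD('n) *\<^sub>R (matrix_inv (Mbar_mat f x) ** M_mat f x)"

end

(* Since f^m is real, d f^m (v) = 2 Re (M v)_m, so by the implicit function theorem the tangent
   space of the zero locus is i M^{-1} R^d.  With B = M^{-1}, the Kaehler form of i B r and i B s
   is the imaginary part of r^T (B^T cnj B) s, which vanishes for all real r, s iff B^T (cnj B) is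
   real; conjugating the relation B^T (cnj B) = (cnj B)^T B by M turns it into the symmetry of
   (cnj B) M.  Similarly Omega takes the value i^d det B det R on the vectors i B R with R real, so
   Im Omega vanishes iff i^d det B is real, that is, iff det N = (-1)^d cnj (det B) / det B = 1. *)

theory Submission
  imports Defs
begin

section \<open>Calculus of \<open>C\<^sup>k\<close> functions\<close>

text \<open>The analytic weight lies in the smoothness clauses: a slice chart must be smooth in both
  directions, and a tangent vector must come from a smooth curve inside the zero locus. A local
  inverse that is merely differentiable does not give this; its smoothness is bootstrapped from the
  linear system that its derivative solves. One chart then yields both the submanifold structure and
  the curves. The sign (-1)^d has its origin in the factor i of each tangent vector: d of them put
  i^d into Omega, and i^d divided by its conjugate is (-1)^d. The submanifold clause of
  \<open>supersymmetric\<close> follows from the hypotheses alone, so the equivalence splits into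
  two statements of linear algebra at each point.\<close>

lemma Ck_on_subset: "Ck_on k U f \<Longrightarrow> V \<subseteq> U \<Longrightarrow> Ck_on k V f"
  by (induction k arbitrary: f) (auto intro: continuous_on_subset)

text \<open>A derivative at a point depends only on values nearby, so on an open set equality of
  functions passes to all their derivatives.\<close>

lemma Ck_on_cong:
  assumes "open U" "Ck_on k U f" "\<And>x. x \<in> U \<Longrightarrow> f x = g x"
  shows "Ck_on k U g"
  using assms(2,3)
proof (induction k arbitrary: f g)
  case 0
  then show ?case by (simp cong: continuous_on_cong)
next
  case (Suc k)
  have *: "(g has_derivative frechet_derivative f (at x)) (at x)" if "x \<in> U" for x
    by (rule has_derivative_transform_within_open[OF _ \<open>open U\<close> that, where f = f])
      (use Suc.prems that in \<open>auto simp: frechet_derivative_works\<close>)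
  then have "frechet_derivative f (at x) = frechet_derivative g (at x)" if "x \<in> U" for x
    using that frechet_derivative_at by blast
  then have "Ck_on k U (\<lambda>x. frechet_derivative g (at x) v)" for v
    using Suc.IH[of "\<lambda>x. frechet_derivative f (at x) v" "\<lambda>x. frechet_derivative g (at x) v"]
      Suc.prems(1) by simp
  with * show ?case by (auto simp: differentiable_def)
qed

text \<open>Trades the Hilbert choice in \<open>frechet_derivative\<close> for an explicit
  derivative; the closure properties below run their induction steps through it.\<close>

lemma Ck_on_SucI:
  assumes "open U" "\<And>x. x \<in> U \<Longrightarrow> (f has_derivative f' x) (at x)"
    and "\<And>v. Ck_on k U (\<lambda>x. f' x v)"
  shows "Ck_on (Suc k) U f"
proof -
  have "Ck_on k U (\<lambda>x. frechet_derivative f (at x) v)" for v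
    by (rule Ck_on_cong[OF assms(1) assms(3)[of v]]) (simp add: frechet_derivative_at[OF assms(2), symmetric])
  with assms(2) show ?thesis by (auto simp: differentiable_def)
qed

lemma Ck_on_Suc_has_derivative:
  assumes "Ck_on (Suc k) U f" "x \<in> U"
  shows "(f has_derivative frechet_derivative f (at x)) (at x)"
  using assms by (simp add: frechet_derivative_works)

text \<open>Product and chain rules leave undifferentiated factors behind; this lemma makes them
  available at the lower order of the induction hypothesis.\<close>

lemma Ck_on_Suc_imp: "Ck_on (Suc k) U f \<Longrightarrow> Ck_on k U f"
proof (induction k arbitrary: f)
  case 0
  then show ?case
    by (auto intro!: continuous_at_imp_continuous_on differentiable_imp_continuous_within)
next
  case (Suc k)
  from Suc.prems have "Ck_on (Suc k) U (\<lambda>x. frechet_derivative f (at x) v)" for v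
    by (metis Ck_on.simps(2))
  with Suc.IH Suc.prems show ?case by (metis Ck_on.simps(2))
qed

lemma Ck_on_const: "Ck_on k U (\<lambda>x. c)"
  by (induction k arbitrary: c) simp_all

lemma Ck_on_ident: "Ck_on k U (\<lambda>x. x)"
  by (cases k) (simp_all add: Ck_on_const)

lemma Ck_on_bounded_linear:
  assumes "bounded_linear L" "open U" "Ck_on k U f"
  shows "Ck_on k U (\<lambda>x. L (f x))"
  using assms(3)
proof (induction k arbitrary: f)
  case 0
  then show ?case by (simp add: bounded_linear.continuous_on[OF assms(1)])
next
  case (Suc k)
  show ?case
  proof (rule Ck_on_SucI[OF \<open>open U\<close>])
    show "((\<lambda>x. L (f x)) has_derivative (\<lambda>v. L (frechet_derivative f (at x) v))) (at x)"
      if "x \<in> U" for x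
      using bounded_linear.has_derivative[OF assms(1) Ck_on_Suc_has_derivative[OF Suc.prems that]] .
    show "Ck_on k U (\<lambda>x. L (frechet_derivative f (at x) v))" for v
      using Suc.prems by (intro Suc.IH) simp
  qed
qed

lemma Ck_on_add:
  assumes "open U" "Ck_on k U f" "Ck_on k U g"
  shows "Ck_on k U (\<lambda>x. f x + g x)"
  using assms(2,3)
proof (induction k arbitrary: f g)
  case 0
  then show ?case by (simp add: continuous_on_add)
next
  case (Suc k)
  show ?case
  proof (rule Ck_on_SucI[OF \<open>open U\<close>])
    show "((\<lambda>x. f x + g x) has_derivative
        (\<lambda>v. frechet_derivative f (at x) v + frechet_derivative g (at x) v)) (at x)"
      if "x \<in> U" for x
      by (intro has_derivative_add Ck_on_Suc_has_derivative[OF Suc.prems(1) that]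
          Ck_on_Suc_has_derivative[OF Suc.prems(2) that])
    show "Ck_on k U (\<lambda>x. frechet_derivative f (at x) v + frechet_derivative g (at x) v)" for v
      using Suc.prems by (intro Suc.IH) simp_all
  qed
qed

lemma Ck_on_sum:
  assumes "open U" "\<And>i. i \<in> I \<Longrightarrow> Ck_on k U (f i)"
  shows "Ck_on k U (\<lambda>x. \<Sum>i\<in>I. f i x)"
proof (cases "finite I")
  case True
  from this assms(2) show ?thesis
    by induction (auto simp: Ck_on_const intro!: Ck_on_add[OF \<open>open U\<close>])
qed (simp add: Ck_on_const)

lemma Ck_on_bounded_bilinear:
  assumes "bounded_bilinear B" "open U" "Ck_on k U f" "Ck_on k U g"
  shows "Ck_on k U (\<lambda>x. B (f x) (g x))"
  using assms(3,4)
proof (induction k arbitrary: f g)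
  case 0
  then show ?case by (simp add: bounded_bilinear.continuous_on[OF assms(1)])
next
  case (Suc k)
  show ?case
  proof (rule Ck_on_SucI[OF \<open>open U\<close>])
    show "((\<lambda>x. B (f x) (g x)) has_derivative
        (\<lambda>v. B (f x) (frechet_derivative g (at x) v) + B (frechet_derivative f (at x) v) (g x))) (at x)"
      if "x \<in> U" for x
      by (intro bounded_bilinear.FDERIV[OF assms(1)] Ck_on_Suc_has_derivative[OF Suc.prems(1) that]
          Ck_on_Suc_has_derivative[OF Suc.prems(2) that])
    show "Ck_on k U (\<lambda>x. B (f x) (frechet_derivative g (at x) v) + B (frechet_derivative f (at x) v) (g x))"
      for v
      using Suc.prems Suc.prems[THEN Ck_on_Suc_imp]
      by (intro Ck_on_add[OF \<open>open U\<close>] Suc.IH) simp_all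
  qed
qed

lemmas Ck_on_mult = Ck_on_bounded_bilinear[OF bounded_bilinear_mult]

lemma Ck_on_prod:
  fixes f :: "'i \<Rightarrow> 'a::euclidean_space \<Rightarrow> 'b::{real_normed_algebra,comm_ring_1}"
  assumes "open U" "\<And>i. i \<in> I \<Longrightarrow> Ck_on k U (f i)"
  shows "Ck_on k U (\<lambda>x. \<Prod>i\<in>I. f i x)"
proof (cases "finite I")
  case True
  from this assms(2) show ?thesis
    by induction (auto simp: Ck_on_const intro!: Ck_on_mult[OF \<open>open U\<close>])
qed (simp add: Ck_on_const)

lemma Ck_on_inverse:
  fixes f :: "'a::euclidean_space \<Rightarrow> 'b::real_normed_field"
  assumes "open U" "Ck_on k U f" "\<And>x. x \<in> U \<Longrightarrow> f x \<noteq> 0"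
  shows "Ck_on k U (\<lambda>x. inverse (f x))"
  using assms(2)
proof (induction k)
  case 0
  then show ?case using assms(3) by (simp add: continuous_on_inverse)
next
  case (Suc k)
  show ?case
  proof (rule Ck_on_SucI[OF \<open>open U\<close>])
    \<comment> \<open>The derivative contains \<open>inverse (f x)\<close> again, which the
      induction hypothesis covers. The minus sign is written as a constant factor so that closure
      under products suffices.\<close>
    show "((\<lambda>x. inverse (f x)) has_derivative
        (\<lambda>v. (- 1) * (inverse (f x) * frechet_derivative f (at x) v * inverse (f x)))) (at x)"
      if "x \<in> U" for x
      using Deriv.has_derivative_inverse[OF assms(3)[OF that] Ck_on_Suc_has_derivative[OF Suc.prems that]]
      by simp
    show "Ck_on k U (\<lambda>x. (- 1) * (inverse (f x) * frechet_derivative f (at x) v * inverse (f x)))" for v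
      using Suc.prems Suc.IH[OF Ck_on_Suc_imp[OF Suc.prems]]
      by (intro Ck_on_mult[OF \<open>open U\<close>] Ck_on_const) simp_all
  qed
qed

lemma linear_euclidean_sum:
  fixes L :: "'a::euclidean_space \<Rightarrow> 'b::real_vector"
  assumes "linear L"
  shows "L v = (\<Sum>b\<in>Basis. (v \<bullet> b) *\<^sub>R L b)"
  by (subst (1) euclidean_representation[of v, symmetric])
    (simp add: linear_sum[OF assms] linear_cmul[OF assms])

text \<open>The chain rule applies a linear map depending on \<open>f x\<close> to a vector
  depending on \<open>x\<close>. Expanding that vector in \<open>Basis\<close> separates the two:
  scalar coefficients from \<open>f\<close>, times directional derivatives of \<open>g\<close>
  composed with \<open>f\<close>. The induction therefore varies \<open>g\<close> and keeps
  \<open>f\<close> fixed.\<close>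

lemma Ck_on_compose:
  fixes g :: "'b::euclidean_space \<Rightarrow> 'c::real_normed_vector"
  assumes "open U" "open V" "Ck_on k U f" "Ck_on k V g" "f ` U \<subseteq> V"
  shows "Ck_on k U (\<lambda>x. g (f x))"
  using assms(3,4)
proof (induction k arbitrary: g)
  case 0
  then show ?case using assms(5) by (simp add: continuous_on_compose2[of V g U f])
next
  case (Suc k)
  define Dg where "Dg = (\<lambda>b x. frechet_derivative g (at x) b)"
  define Df where "Df = (\<lambda>v x. frechet_derivative f (at x) v)"
  show ?case
  proof (rule Ck_on_SucI[OF \<open>open U\<close>])
    fix x assume "x \<in> U"
    then have g: "(g has_derivative frechet_derivative g (at (f x))) (at (f x))"
      using assms(5) Suc.prems by (intro Ck_on_Suc_has_derivative) auto
    have "(g \<circ> f has_derivative (frechet_derivative g (at (f x)) \<circ> frechet_derivative f (at x))) (at x)"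
      by (intro diff_chain_at g Ck_on_Suc_has_derivative[OF Suc.prems(1) \<open>x \<in> U\<close>])
    moreover have "frechet_derivative g (at (f x)) (Df v x)
        = (\<Sum>b\<in>Basis. (Df v x \<bullet> b) *\<^sub>R Dg b (f x))" for v
      unfolding Dg_def by (rule linear_euclidean_sum) (rule has_derivative_linear[OF g])
    ultimately show "((\<lambda>x. g (f x)) has_derivative (\<lambda>v. \<Sum>b\<in>Basis. (Df v x \<bullet> b) *\<^sub>R Dg b (f x))) (at x)"
      by (simp add: o_def Df_def)
  next
    fix v
    have "Ck_on k U (\<lambda>x. Dg b (f x))" for b
      using Suc.prems Ck_on_Suc_imp[OF Suc.prems(1)] by (intro Suc.IH) (simp_all add: Dg_def)
    moreover have "Ck_on k U (Df v)"
      using Suc.prems by (simp add: Df_def)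
    ultimately show "Ck_on k U (\<lambda>x. \<Sum>b\<in>Basis. (Df v x \<bullet> b) *\<^sub>R Dg b (f x))"
      by (intro Ck_on_sum Ck_on_bounded_bilinear[OF bounded_bilinear_scaleR]
          Ck_on_bounded_linear[OF bounded_linear_inner_left] assms(1))
  qed
qed

lemma Ck_on_componentwise:
  fixes f :: "'a::euclidean_space \<Rightarrow> 'b::euclidean_space"
  assumes "open U" "\<And>b. b \<in> Basis \<Longrightarrow> Ck_on k U (\<lambda>x. f x \<bullet> b)"
  shows "Ck_on k U f"
proof -
  have "Ck_on k U (\<lambda>x. \<Sum>b\<in>Basis. (f x \<bullet> b) *\<^sub>R b)"
    by (intro Ck_on_sum assms Ck_on_bounded_linear[OF bounded_linear_scaleR_left])
  then show ?thesis by (simp add: euclidean_representation)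
qed

lemma Ck_on_det:
  fixes A :: "'a::euclidean_space \<Rightarrow> real ^ 'k ^ 'k"
  assumes "open U" "\<And>i j. Ck_on k U (\<lambda>x. A x $ i $ j)"
  shows "Ck_on k U (\<lambda>x. det (A x))"
  unfolding det_def by (intro Ck_on_sum Ck_on_mult Ck_on_prod Ck_on_const assms)

text \<open>Cramer's rule: a coordinate of the solution is a quotient of determinants, hence
  rational in the entries of \<open>A x\<close> with nonvanishing denominator.\<close>

lemma Ck_on_linear_solution:
  fixes A :: "'a::euclidean_space \<Rightarrow> real ^ 'k ^ 'k"
  assumes "open U" "\<And>i j. Ck_on k U (\<lambda>x. A x $ i $ j)" "\<And>x. x \<in> U \<Longrightarrow> invertible (A x)"
    and "\<And>x. x \<in> U \<Longrightarrow> A x *v h x = c"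
  shows "Ck_on k U (\<lambda>x. h x $ j)"
proof (rule Ck_on_cong[OF \<open>open U\<close>])
  let ?h = "\<lambda>x. det (\<chi> i l. if l = j then c $ i else A x $ i $ l) * inverse (det (A x))"
  show "Ck_on k U ?h"
  proof (intro Ck_on_mult Ck_on_inverse Ck_on_det assms(1,2))
    show "Ck_on k U (\<lambda>x. (\<chi> i l. if l = j then c $ i else A x $ i $ l) $ i $ l)" for i l
      using assms(2)[of i l] by (cases "l = j") (simp_all add: Ck_on_const)
    show "det (A x) \<noteq> 0" if "x \<in> U" for x
      using assms(3)[OF that] by (simp add: invertible_det_nz)
  qed
  show "?h x = h x $ j" if "x \<in> U" for x
    using cramer[of "A x" "h x" c] assms(3,4)[OF that] by (simp add: invertible_det_nz field_simps)
qed

section \<open>The smooth inverse function theorem\<close>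

text \<open>The index type \<open>'k\<close> only enumerates a basis, so that determinants of matrices
  with respect to it are available.\<close>

lemma Ck_on_inverse_function:
  fixes F g :: "'a::euclidean_space \<Rightarrow> 'a" and b :: "'k::finite \<Rightarrow> 'a"
  assumes "bij_betw b UNIV Basis" "open U" "open V" "smooth_on U F" "homeomorphism U V F g"
    and g': "\<And>y. y \<in> V \<Longrightarrow> (g has_derivative g' y) (at y)"
    and bij: "\<And>x. x \<in> U \<Longrightarrow> bij (frechet_derivative F (at x))"
    and inv: "\<And>y v. y \<in> V \<Longrightarrow> frechet_derivative F (at (g y)) (g' y v) = v"
  shows "Ck_on k V g"
proof (induction k)
  case 0
  then show ?case using assms(5) by (simp add: homeomorphism_def)
next
  case (Suc k)
  have gV: "g ` V \<subseteq> U" using assms(5) by (simp add: homeomorphism_def)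
  have inj_b: "b i = b j \<longleftrightarrow> i = j" for i j
    using assms(1) by (auto simp: bij_betw_def inj_def)
  have b_Basis: "b i \<in> Basis" for i using assms(1) by (auto simp: bij_betw_def)
  have sum_Basis: "(\<Sum>i\<in>UNIV. f (b i)) = (\<Sum>c\<in>Basis. f c)" for f :: "'a \<Rightarrow> 'a"
    by (rule sum.reindex_bij_betw[OF assms(1)])
  have Basis_b: "\<exists>i. c = b i" if "c \<in> Basis" for c
    using that assms(1) by (auto simp: bij_betw_def)
  \<comment> \<open>The Jacobian matrix of \<open>F\<close> at \<open>g y\<close> in the basis
    \<open>b\<close>. The coordinates of \<open>g' y v\<close> solve a linear system with this
    matrix and a right-hand side independent of \<open>y\<close>.\<close>
  define A where "A = (\<lambda>y. \<chi> i j. frechet_derivative F (at (g y)) (b j) \<bullet> b i)"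
  have lin: "linear (frechet_derivative F (at x))" if "x \<in> U" for x
    using assms(4) that unfolding smooth_on_def
    by (metis Ck_on.simps(2) linear_frechet_derivative)
  have A_mult: "(A y *v w) $ i = frechet_derivative F (at (g y)) (\<Sum>j\<in>UNIV. w $ j *\<^sub>R b j) \<bullet> b i"
    if "y \<in> V" for y w i
    using lin[of "g y"] gV that
    by (simp add: A_def matrix_vector_mult_def linear_sum linear_cmul inner_sum_left image_subset_iff
        mult.commute)
  have A_inv: "invertible (A y)" if "y \<in> V" for y
  proof -
    have "w = 0" if "A y *v w = 0" for w
    proof -
      let ?w = "\<Sum>j\<in>UNIV. w $ j *\<^sub>R b j"
      have "frechet_derivative F (at (g y)) ?w \<bullet> b i = 0" for i
        using A_mult[OF \<open>y \<in> V\<close>, of w i] that by simp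
      then have "frechet_derivative F (at (g y)) ?w = 0"
        using Basis_b by (metis euclidean_all_zero_iff)
      moreover have "g y \<in> U" using gV \<open>y \<in> V\<close> by auto
      ultimately have w: "?w = 0"
        using bij[of "g y"] linear_0[OF lin, of "g y"] by (metis bij_is_inj injD)
      have "?w \<bullet> b i = w $ i" for i
        by (simp add: inner_sum_left inner_Basis b_Basis inj_b if_distrib cong: if_cong)
      then show "w = 0" unfolding w by (simp add: vec_eq_iff)
    qed
    then show ?thesis
      by (metis invertible_left_inverse matrix_left_invertible_ker)
  qed
  show ?case
  proof (rule Ck_on_SucI[OF \<open>open V\<close> g'])
    fix v
    have "Ck_on k V (\<lambda>y. g' y v \<bullet> b j)" for j
    proof -
      have "Ck_on k V (\<lambda>y. (\<chi> j. g' y v \<bullet> b j) $ j)"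
      proof (rule Ck_on_linear_solution[OF \<open>open V\<close> _ A_inv])
        fix i j
        \<comment> \<open>The bootstrap: \<open>g\<close> has order \<open>k\<close> by the
          induction hypothesis, hence so have the entries of \<open>A\<close>, which are derivatives
          of \<open>F\<close> composed with \<open>g\<close>. Solving the system gives
          \<open>g'\<close> order \<open>k\<close> and thus \<open>g\<close> order
          \<open>Suc k\<close>.\<close>
        have "Ck_on k U (\<lambda>x. frechet_derivative F (at x) (b j))"
          using assms(4) unfolding smooth_on_def by (metis Ck_on.simps(2))
        then show "Ck_on k V (\<lambda>y. A y $ i $ j)"
          unfolding A_def using Suc
          by (auto intro!: Ck_on_bounded_linear[OF bounded_linear_inner_left]
              Ck_on_compose[of V U k g] gV assms)
      next
        fix y assume "y \<in> V"
        have "(\<Sum>j\<in>UNIV. (g' y v \<bullet> b j) *\<^sub>R b j) = g' y v"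
          by (simp add: sum_Basis[of "\<lambda>c. (g' y v \<bullet> c) *\<^sub>R c"] euclidean_representation)
        with \<open>y \<in> V\<close> show "A y *v (\<chi> j. g' y v \<bullet> b j) = (\<chi> i. v \<bullet> b i)"
          by (simp add: vec_eq_iff A_mult inv)
      qed
      then show ?thesis by simp
    qed
    then show "Ck_on k V (\<lambda>y. g' y v)"
      using Ck_on_componentwise[OF \<open>open V\<close>, of k "\<lambda>y. g' y v"] Basis_b by metis
  qed
qed

lemma smooth_on_has_derivative:
  assumes "smooth_on U f" "x \<in> U"
  shows "(f has_derivative frechet_derivative f (at x)) (at x)"
  using assms Ck_on_Suc_has_derivative unfolding smooth_on_def by blast

text \<open>The formula for the derivative of \<open>g\<close> is kept in the conclusion because it
  later determines the velocity of curves pulled back through a chart.\<close>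

lemma smooth_inverse_function_theorem:
  fixes F :: "'a::euclidean_space \<Rightarrow> 'a" and b :: "'k::finite \<Rightarrow> 'a"
  assumes b: "bij_betw b UNIV Basis" and "open W" "p \<in> W" "smooth_on W F"
    and inj: "inj (frechet_derivative F (at p))"
  obtains U V g where "open U" "U \<subseteq> W" "p \<in> U" "open V" "homeomorphism U V F g" "smooth_on V g"
    "\<And>y. y \<in> V \<Longrightarrow> (g has_derivative inv (frechet_derivative F (at (g y)))) (at y)"
proof -
  \<comment> \<open>The inverse function theorem wants a derivative that is continuous in operator
    norm. \<open>Ck_on\<close> gives continuity in each direction, which is the same in finite
    dimension.\<close>
  define F' where "F' = (\<lambda>x. Blinfun (frechet_derivative F (at x)))"
  have F': "blinfun_apply (F' x) = frechet_derivative F (at x)" if "x \<in> W" for x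
    unfolding F'_def using smooth_on_has_derivative[OF assms(4) that]
    by (simp add: bounded_linear_Blinfun_apply has_derivative_bounded_linear)
  have der: "(F has_derivative blinfun_apply (F' x)) (at x)" if "x \<in> W" for x
    using smooth_on_has_derivative[OF assms(4) that] by (simp add: F'[OF that])
  have "continuous_on W (\<lambda>x. blinfun_apply (F' x) v)" for v
  proof -
    have "Ck_on (Suc 0) W F" using assms(4) unfolding smooth_on_def by blast
    then have "continuous_on W (\<lambda>x. frechet_derivative F (at x) v)" by simp
    then show ?thesis by (simp add: F' cong: continuous_on_cong)
  qed
  then have cont: "continuous_on W F'" by (intro continuous_on_blinfun_componentwise)
  obtain h where h: "linear h" "h \<circ> frechet_derivative F (at p) = id"
    using linear_injective_left_inverse[OF has_derivative_linear[OF smooth_on_has_derivative] inj] assms(3,4)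
    by blast
  have "Blinfun h o\<^sub>L F' p = id_blinfun"
    using h by (intro blinfun_eqI)
      (simp add: F' assms(3) bounded_linear_Blinfun_apply linear_conv_bounded_linear pointfree_idE)
  from inverse_function_theorem[OF \<open>open W\<close> der cont \<open>p \<in> W\<close> this]
  obtain U V g g' where UV: "open U" "U \<subseteq> W" "p \<in> U" "open V" "homeomorphism U V F g"
    and g': "\<And>y. y \<in> V \<Longrightarrow> (g has_derivative (g' y)) (at y)"
      "\<And>y. y \<in> V \<Longrightarrow> g' y = inv (blinfun_apply (F' (g y)))"
      "\<And>y. y \<in> V \<Longrightarrow> bij (blinfun_apply (F' (g y)))"
    by metis
  have gU: "g y \<in> U" if "y \<in> V" for y
    using UV(5) that by (auto simp: homeomorphism_def)
  have g'_inv: "g' y = inv (frechet_derivative F (at (g y)))" if "y \<in> V" for y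
    using g'(2)[OF that] F' gU[OF that] UV(2) by auto
  have bij: "bij (frechet_derivative F (at (g y)))" if "y \<in> V" for y
    using g'(3)[OF that] F' gU[OF that] UV(2) by auto
  have "Ck_on k V g" for k
  proof (rule Ck_on_inverse_function[OF b UV(1,4) _ UV(5) g'(1)])
    show "smooth_on U F"
      using assms(4) UV(2) by (auto simp: smooth_on_def intro: Ck_on_subset)
    show "bij (frechet_derivative F (at x))" if "x \<in> U" for x
      using bij[of "F x"] UV(5) that by (force simp: homeomorphism_def)
    show "frechet_derivative F (at (g y)) (g' y v) = v" if "y \<in> V" for y v
      using bij[OF that] by (simp add: g'_inv[OF that] bij_is_surj surj_f_inv_f)
  qed
  then have "smooth_on V g" by (simp add: smooth_on_def)
  with UV g'(1) g'_inv show ?thesis by (intro that) auto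
qed

section \<open>Slice charts and tangent spaces of the zero locus\<close>

lemma partial_deriv_eq_frechet_derivative:
  assumes "f differentiable (at x)"
  shows "partial_deriv f e x = frechet_derivative f (at x) e"
proof -
  let ?D = "frechet_derivative f (at x)"
  have D: "(f has_derivative ?D) (at (x + 0 *\<^sub>R e))"
    using assms by (simp add: frechet_derivative_works)
  have "((\<lambda>t::real. x + t *\<^sub>R e) has_derivative (\<lambda>t. t *\<^sub>R e)) (at 0)"
    by (auto intro!: derivative_eq_intros)
  from diff_chain_at[OF this D]
  have "((\<lambda>t::real. f (x + t *\<^sub>R e)) has_derivative (\<lambda>t. ?D (t *\<^sub>R e))) (at 0)"
    by (simp add: o_def)
  moreover have "?D (t *\<^sub>R e) = ?D e * t" for t
    using linear_cmul[OF linear_frechet_derivative[OF assms]] by simp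
  ultimately have "((\<lambda>t::real. f (x + t *\<^sub>R e)) has_field_derivative ?D e) (at 0)"
    by (simp add: has_field_derivative_def)
  then show ?thesis
    unfolding partial_deriv_def by (rule DERIV_imp_deriv)
qed

lemma vec_complex_expansion:
  "v = (\<Sum>n\<in>UNIV. Re (v $ n) *\<^sub>R axis n 1 + Im (v $ n) *\<^sub>R axis n \<i>)"
  by (simp add: vec_eq_iff axis_def if_distrib sum.distrib complex_eq_iff cong: if_cong)

text \<open>For a real function the conjugate half of the differential is the complex conjugate of
  the holomorphic half, so the two add up to twice a real part.\<close>

lemma frechet_derivative_eq_M_mat:
  assumes "f m differentiable (at x)"
  shows "frechet_derivative (f m) (at x) v = 2 * Re ((M_mat f x *v v) $ m)"
proof -
  let ?D = "frechet_derivative (f m) (at x)"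
  have "?D v = (\<Sum>n\<in>UNIV. Re (v $ n) * ?D (axis n 1) + Im (v $ n) * ?D (axis n \<i>))"
    using linear_frechet_derivative[OF assms]
    by (subst vec_complex_expansion[of v]) (simp add: linear_sum linear_add linear_cmul)
  also have "\<dots> = 2 * Re ((M_mat f x *v v) $ m)"
    by (simp add: M_mat_def matrix_vector_mult_def wirtinger_def sum_distrib_left
        partial_deriv_eq_frechet_derivative[OF assms] algebra_simps)
  finally show ?thesis .
qed

text \<open>Supplies the basis enumeration for the inverse function theorem: the index type is
  \<open>'n\<close> paired with a boolean that selects the real or the imaginary direction.\<close>

lemma bij_betw_Basis_complex_vec:
  "bij_betw (\<lambda>(n::'n::finite, c). axis n (if c then 1 else \<i>)) UNIV (Basis :: (complex ^ 'n) set)"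
  by (auto simp: bij_betw_def inj_on_def axis_eq_axis Basis_vec_def Basis_complex_def image_iff
      split: if_splits)

text \<open>The real parts of these coordinates cut out the zero locus; the imaginary parts are those
  of the linear map \<open>M(p)\<close>, which makes the derivative at \<open>p\<close> essentially \<open>M(p)\<close> itself.\<close>

definition slice_coords ::
    "('n::finite \<Rightarrow> complex ^ 'n \<Rightarrow> real) \<Rightarrow> complex ^ 'n \<Rightarrow> complex ^ 'n \<Rightarrow> complex ^ 'n" where
  "slice_coords f p x = (\<chi> m. Complex (f m x) (Im ((M_mat f p *v x) $ m)))"

text \<open>The real subspace i R^d of C^d. It is the linear slice of every chart and also the image
  of each tangent space under \<open>M_mat f p\<close>.\<close>

definition imaginary_vecs :: "(complex ^ 'n) set" where
  "imaginary_vecs = {y. \<forall>m. Re (y $ m) = 0}"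

lemma mem_imaginary_vecs: "y \<in> imaginary_vecs \<longleftrightarrow> (\<forall>m. Re (y $ m) = 0)"
  by (simp add: imaginary_vecs_def)

lemma subspace_imaginary_vecs: "subspace imaginary_vecs"
  by (simp add: subspace_def mem_imaginary_vecs)

lemma dim_imaginary_vecs: "dim (imaginary_vecs :: (complex ^ 'n::finite) set) = CARD('n)"
proof -
  let ?L = "\<lambda>r :: real ^ 'n. (\<chi> m. Complex 0 (r $ m)) :: complex ^ 'n"
  have "linear ?L"
    by (intro linearI) (simp_all add: vec_eq_iff complex_eq_iff)
  moreover have "inj ?L"
    by (simp add: inj_def vec_eq_iff)
  ultimately have "dim (?L ` UNIV) = dim (UNIV :: (real ^ 'n) set)"
    by (intro dim_image_eq) (auto intro: inj_on_subset)
  also have "?L ` UNIV = imaginary_vecs"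
  proof -
    have "y = ?L (\<chi> m. Im (y $ m))" if "y \<in> imaginary_vecs" for y
      using that by (simp add: mem_imaginary_vecs vec_eq_iff complex_eq_iff)
    then show ?thesis by (fastforce simp: mem_imaginary_vecs)
  qed
  finally show ?thesis by simp
qed

lemma slice_coords_mem_imaginary_vecs:
  "slice_coords f p x \<in> imaginary_vecs \<longleftrightarrow> x \<in> zero_locus f"
  by (simp add: slice_coords_def mem_imaginary_vecs zero_locus_def)

lemma linear_matrix_vector_complex: "linear ((*v) (A :: complex ^ 'n ^ 'm))"
  by (intro linearI)
    (simp_all add: vec_eq_iff matrix_vector_mult_def scaleR_sum_right distrib_left sum.distrib)

lemma bounded_linear_Im_matrix_vector:
  "bounded_linear (\<lambda>x. Im (((A :: complex ^ 'n::finite ^ 'm::finite) *v x) $ i))"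
  using linear_matrix_vector_complex[of A]
  by (auto intro!: bounded_linear_compose[OF bounded_linear_Im]
      bounded_linear_compose[OF bounded_linear_vec_nth] simp: linear_conv_bounded_linear)

lemma smooth_slice_coords:
  assumes "\<And>m. smooth_on UNIV (f m)"
  shows "smooth_on UNIV (slice_coords f p)"
  unfolding smooth_on_def
proof (intro allI, rule Ck_on_componentwise)
  fix k and b :: "complex ^ 'a"
  assume "b \<in> Basis"
  then obtain n where "b = axis n 1 \<or> b = axis n \<i>"
    by (auto simp: Basis_vec_def Basis_complex_def)
  moreover have "Ck_on k UNIV (f n)"
    using assms by (simp add: smooth_on_def)
  moreover have "Ck_on k UNIV (\<lambda>x. Im ((M_mat f p *v x) $ n))"
    by (rule Ck_on_bounded_linear[OF bounded_linear_Im_matrix_vector open_UNIV Ck_on_ident])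
  ultimately show "Ck_on k UNIV (\<lambda>x. slice_coords f p x \<bullet> b)"
    by (auto simp: slice_coords_def inner_axis inner_complex_def)
qed simp

lemma slice_coords_has_derivative:
  fixes f :: "'n::finite \<Rightarrow> complex ^ 'n \<Rightarrow> real"
  assumes "\<And>m. smooth_on UNIV (f m)"
  shows "(slice_coords f p has_derivative
    (\<lambda>v. \<chi> m. Complex (2 * Re ((M_mat f x *v v) $ m)) (Im ((M_mat f p *v v) $ m)))) (at x)"
proof (subst has_derivative_componentwise_within, intro ballI)
  fix b :: "complex ^ 'n" assume "b \<in> Basis"
  then obtain n where n: "b = axis n 1 \<or> b = axis n \<i>"
    by (auto simp: Basis_vec_def Basis_complex_def)
  have f: "(f n has_derivative frechet_derivative (f n) (at x)) (at x)"
    using smooth_on_has_derivative[OF assms] by simp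
  then have "frechet_derivative (f n) (at x) v = 2 * Re ((M_mat f x *v v) $ n)" for v
    using frechet_derivative_eq_M_mat differentiable_def by blast
  then have "frechet_derivative (f n) (at x) = (\<lambda>v. 2 * Re ((M_mat f x *v v) $ n))"
    by auto
  with f have "(f n has_derivative (\<lambda>v. 2 * Re ((M_mat f x *v v) $ n))) (at x)"
    by simp
  moreover have "((\<lambda>x. Im ((M_mat f p *v x) $ n)) has_derivative (\<lambda>v. Im ((M_mat f p *v v) $ n))) (at x)"
    by (rule bounded_linear_imp_has_derivative[OF bounded_linear_Im_matrix_vector])
  ultimately show "((\<lambda>x. slice_coords f p x \<bullet> b) has_derivative
      (\<lambda>v. (\<chi> m. Complex (2 * Re ((M_mat f x *v v) $ m)) (Im ((M_mat f p *v v) $ m))) \<bullet> b)) (at x)"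
    using n by (auto simp: slice_coords_def inner_axis inner_complex_def)
qed

text \<open>Serves two purposes: the homeomorphism straightens the zero locus, while the derivative
  of \<open>g\<close> and the bijectivity at \<open>p\<close> allow curves of prescribed
  velocity.\<close>

lemma zero_locus_slice_chart:
  fixes f :: "'n::finite \<Rightarrow> complex ^ 'n \<Rightarrow> real"
  assumes smooth: "\<And>m. smooth_on UNIV (f m)" and inv: "invertible (M_mat f p)"
  obtains U V g where "open U" "p \<in> U" "open V" "homeomorphism U V (slice_coords f p) g"
    "smooth_on V g" "slice_coords f p ` (zero_locus f \<inter> U) = V \<inter> imaginary_vecs"
    "(g has_derivative inv (frechet_derivative (slice_coords f p) (at p))) (at (slice_coords f p p))"
    "bij (frechet_derivative (slice_coords f p) (at p))"
proof -
  let ?F = "slice_coords f p"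
  let ?D = "frechet_derivative ?F (at p)"
  have D: "?D = (\<lambda>v. \<chi> m. Complex (2 * Re ((M_mat f p *v v) $ m)) (Im ((M_mat f p *v v) $ m)))"
    using frechet_derivative_at[OF slice_coords_has_derivative[OF smooth]] by simp
  have "inj ?D"
  proof (rule injI)
    fix v w assume "?D v = ?D w"
    then have "M_mat f p *v v = M_mat f p *v w"
      by (simp add: D vec_eq_iff complex_eq_iff)
    then show "v = w"
      using inv by (metis inj_matrix_vector_mult injD)
  qed
  from smooth_inverse_function_theorem[OF bij_betw_Basis_complex_vec open_UNIV UNIV_I
      smooth_slice_coords[OF smooth] this]
  obtain U V g where UV: "open U" "p \<in> U" "open V" "homeomorphism U V ?F g" "smooth_on V g"
    and g: "\<And>y. y \<in> V \<Longrightarrow> (g has_derivative inv (frechet_derivative ?F (at (g y)))) (at y)"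
    by metis
  have "g (?F p) = p" "?F p \<in> V"
    using UV by (auto simp: homeomorphism_def)
  with g[of "?F p"] have "(g has_derivative inv ?D) (at (?F p))" by simp
  moreover have "?F ` (zero_locus f \<inter> U) = V \<inter> imaginary_vecs"
    using UV(4) slice_coords_mem_imaginary_vecs[of f p]
    by (force simp: homeomorphism_def)
  moreover have "linear ?D"
    using has_derivative_linear[OF smooth_on_has_derivative[OF smooth_slice_coords[OF smooth] UNIV_I]] .
  then have "bij ?D"
    using \<open>inj ?D\<close> by (simp add: bij_def linear_injective_imp_surjective)
  ultimately show ?thesis using UV that by blast
qed

lemma embedded_submanifold_zero_locus:
  fixes f :: "'n::finite \<Rightarrow> complex ^ 'n \<Rightarrow> real"
  assumes "\<And>m. smooth_on UNIV (f m)" "\<And>x. x \<in> zero_locus f \<Longrightarrow> invertible (M_mat f x)"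
  shows "embedded_submanifold CARD('n) (zero_locus f)"
  unfolding embedded_submanifold_def
proof
  fix p assume "p \<in> zero_locus f"
  obtain U V g where UV: "open U" "p \<in> U" "open V" "homeomorphism U V (slice_coords f p) g"
    "smooth_on V g" "slice_coords f p ` (zero_locus f \<inter> U) = V \<inter> imaginary_vecs"
    using zero_locus_slice_chart[OF assms(1) assms(2)[OF \<open>p \<in> zero_locus f\<close>]] .
  moreover have "smooth_on U (slice_coords f p)"
    using smooth_slice_coords[of f, where p = p] assms(1) by (auto simp: smooth_on_def intro: Ck_on_subset)
  ultimately show "\<exists>U V \<phi> \<psi> (L :: (complex ^ 'n) set).
      open U \<and> p \<in> U \<and> open V \<and> homeomorphism U V \<phi> \<psi> \<and> smooth_on U \<phi> \<and> smooth_on V \<psi> \<and>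
      subspace L \<and> dim L = CARD('n) \<and> \<phi> ` (zero_locus f \<inter> U) = V \<inter> L"
    using subspace_imaginary_vecs dim_imaginary_vecs[where 'n = 'n] by blast
qed

lemma tangent_space_zero_locus:
  fixes f :: "'n::finite \<Rightarrow> complex ^ 'n \<Rightarrow> real"
  assumes smooth: "\<And>m. smooth_on UNIV (f m)" and p: "p \<in> zero_locus f"
    and inv: "invertible (M_mat f p)"
  shows "tangent_space (zero_locus f) p = {v. M_mat f p *v v \<in> imaginary_vecs}"
proof (intro equalityI subsetI)
  fix v assume "v \<in> tangent_space (zero_locus f) p"
  then obtain \<gamma> :: "real \<Rightarrow> _" and \<epsilon> where \<gamma>: "\<epsilon> > 0" "\<gamma> ` {-\<epsilon><..<\<epsilon>} \<subseteq> zero_locus f" "\<gamma> 0 = p"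
    "(\<gamma> has_vector_derivative v) (at 0)"
    by (auto simp: tangent_space_def)
  have "Re ((M_mat f p *v v) $ m) = 0" for m
  proof -
    let ?D = "frechet_derivative (f m) (at p)"
    have D: "(f m has_derivative ?D) (at (\<gamma> 0))"
      using smooth_on_has_derivative[OF smooth] \<gamma>(3) by simp
    have "((f m \<circ> \<gamma>) has_derivative (?D \<circ> (\<lambda>t. t *\<^sub>R v))) (at 0)"
      using \<gamma>(4) D by (intro diff_chain_at) (simp_all add: has_vector_derivative_def)
    \<comment> \<open>The curve stays in the zero locus, so the composite vanishes near 0;
      uniqueness of derivatives then forces \<open>?D v = 0\<close>.\<close>
    moreover have "((f m \<circ> \<gamma>) has_derivative (\<lambda>_. 0)) (at 0)"
    proof (rule has_derivative_transform_within_open[OF has_derivative_const[of 0]])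
      show "0 = (f m \<circ> \<gamma>) t" if "t \<in> {-\<epsilon><..<\<epsilon>}" for t
        using image_subset_iff[THEN iffD1, OF \<gamma>(2)] that by (simp add: zero_locus_def)
    qed (use \<gamma>(1) in auto)
    ultimately have "?D \<circ> (\<lambda>t. t *\<^sub>R v) = (\<lambda>_. 0)"
      by (rule has_derivative_unique)
    then have "?D v = 0"
      by (metis comp_apply scaleR_one)
    then show ?thesis
      using D \<gamma>(3) frechet_derivative_eq_M_mat[of f m p v] by (auto simp: differentiable_def)
  qed
  then show "v \<in> {v. M_mat f p *v v \<in> imaginary_vecs}"
    by (simp add: mem_imaginary_vecs)
next
  fix v assume v: "v \<in> {v. M_mat f p *v v \<in> imaginary_vecs}"
  let ?F = "slice_coords f p"
  let ?D = "frechet_derivative ?F (at p)"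
  obtain U V g where UV: "open U" "p \<in> U" "open V" "homeomorphism U V ?F g" "smooth_on V g"
      "?F ` (zero_locus f \<inter> U) = V \<inter> imaginary_vecs"
    and g: "(g has_derivative inv ?D) (at (?F p))" and bij: "bij ?D"
    using zero_locus_slice_chart[OF smooth inv] .
  have D: "?D = (\<lambda>v. \<chi> m. Complex (2 * Re ((M_mat f p *v v) $ m)) (Im ((M_mat f p *v v) $ m)))"
    using frechet_derivative_at[OF slice_coords_has_derivative[OF smooth]] by simp
  have Dv: "?D v \<in> imaginary_vecs"
    using v by (simp add: D mem_imaginary_vecs)
  have gF: "g (?F p) = p" "?F p \<in> V"
    using UV by (auto simp: homeomorphism_def)
  \<comment> \<open>A straight line inside the slice: its starting point is imaginary because
    \<open>p\<close> is a zero, its direction because \<open>M_mat f p *v v\<close> is imaginary.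
    The inverse chart bends it into a curve in the zero locus with velocity
    \<open>inv ?D (?D v) = v\<close>.\<close>
  define line where "line = (\<lambda>t::real. ?F p + t *\<^sub>R ?D v)"
  have line_imag: "line t \<in> imaginary_vecs" for t
    using Dv slice_coords_mem_imaginary_vecs[of f p p] p
    by (simp add: line_def subspace_add[OF subspace_imaginary_vecs] subspace_scale[OF subspace_imaginary_vecs])
  have "continuous_on UNIV line"
    unfolding line_def by (intro continuous_intros)
  then have "open (line -` V)"
    using UV(3) by (simp add: continuous_on_open_vimage)
  moreover have "0 \<in> line -` V"
    using gF by (simp add: line_def)
  ultimately obtain \<epsilon> where \<epsilon>: "\<epsilon> > 0" "ball 0 \<epsilon> \<subseteq> line -` V"
    using openE by blast
  then have line_V: "line ` {-\<epsilon><..<\<epsilon>} \<subseteq> V"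
    by (force simp: ball_def dist_real_def)
  have "smooth_on {-\<epsilon><..<\<epsilon>} (\<lambda>t. g (line t))"
    unfolding smooth_on_def
  proof
    fix k
    have "Ck_on k {-\<epsilon><..<\<epsilon>} line"
      unfolding line_def
      by (rule Ck_on_add[OF _ Ck_on_const Ck_on_bounded_linear[OF bounded_linear_scaleR_left _ Ck_on_ident]])
        simp_all
    moreover have "Ck_on k V g"
      using UV(5) by (simp add: smooth_on_def)
    ultimately show "Ck_on k {-\<epsilon><..<\<epsilon>} (\<lambda>t. g (line t))"
      using Ck_on_compose[OF _ UV(3) _ _ line_V] by (metis open_greaterThanLessThan)
  qed
  moreover have "(\<lambda>t. g (line t)) ` {-\<epsilon><..<\<epsilon>} \<subseteq> zero_locus f"
  proof
    fix x assume "x \<in> (\<lambda>t. g (line t)) ` {-\<epsilon><..<\<epsilon>}"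
    then obtain t where t: "t \<in> {-\<epsilon><..<\<epsilon>}" "x = g (line t)" by blast
    with line_V line_imag UV(6) have "line t \<in> ?F ` (zero_locus f \<inter> U)" by blast
    then obtain z where "z \<in> zero_locus f" "z \<in> U" "line t = ?F z" by blast
    with t(2) UV(4) show "x \<in> zero_locus f" by (simp add: homeomorphism_def)
  qed
  moreover have "g (line 0) = p" using gF by (simp add: line_def)
  moreover have "((\<lambda>t. g (line t)) has_vector_derivative v) (at 0)"
  proof -
    have "(line has_derivative (\<lambda>t. t *\<^sub>R ?D v)) (at 0)"
      unfolding line_def by (auto intro!: derivative_eq_intros)
    moreover have "(g has_derivative inv ?D) (at (line 0))"
      using g by (simp add: line_def)
    ultimately have "(g \<circ> line has_derivative (inv ?D \<circ> (\<lambda>t. t *\<^sub>R ?D v))) (at 0)"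
      by (rule diff_chain_at)
    moreover have "inv ?D (t *\<^sub>R ?D v) = t *\<^sub>R v" for t
      using linear_cmul[OF has_derivative_linear[OF g]] bij by (simp add: bij_is_inj)
    ultimately show ?thesis by (simp add: has_vector_derivative_def o_def)
  qed
  ultimately show "v \<in> tangent_space (zero_locus f) p"
    using \<epsilon>(1) unfolding tangent_space_def by blast
qed

section \<open>The two forms on the tangent spaces\<close>

definition cnj_mat :: "complex ^ 'n ^ 'm \<Rightarrow> complex ^ 'n ^ 'm" where
  "cnj_mat A = (\<chi> i j. cnj (A $ i $ j))"

lemma cnj_mat_mult: "cnj_mat (A ** B) = cnj_mat A ** cnj_mat B"
  by (simp add: cnj_mat_def matrix_matrix_mult_def vec_eq_iff)

lemma cnj_mat_one: "cnj_mat (mat 1) = mat 1"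
  by (simp add: cnj_mat_def mat_def vec_eq_iff)

lemma cnj_mat_transpose: "cnj_mat (transpose A) = transpose (cnj_mat A)"
  by (simp add: cnj_mat_def transpose_def)

lemma cnj_mat_cnj_mat [simp]: "cnj_mat (cnj_mat A) = A"
  by (simp add: cnj_mat_def vec_eq_iff)

lemma det_cnj_mat: "det (cnj_mat A) = cnj (det A)"
  by (simp add: det_def cnj_mat_def)

lemma Mbar_mat_eq_cnj_mat: "Mbar_mat f x = cnj_mat (M_mat f x)"
  by (simp add: Mbar_mat_def M_mat_def cnj_mat_def wirtinger_def wirtinger_bar_def vec_eq_iff)

lemma cnj_mat_eq_self_iff: "cnj_mat A = A \<longleftrightarrow> (\<forall>i j. Im (A $ i $ j) = 0)"
  by (auto simp: cnj_mat_def vec_eq_iff complex_eq_iff)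

text \<open>\<open>matrix_inv\<close> is a Hilbert choice; an explicit two-sided inverse pins down
  its value.\<close>

lemma matrix_inv_unique:
  fixes A :: "'a::semiring_1 ^ 'n ^ 'm"
  assumes "A ** B = mat 1" "B ** A = mat 1"
  shows "matrix_inv A = B"
proof -
  have "A ** matrix_inv A = mat 1 \<and> matrix_inv A ** A = mat 1"
    unfolding matrix_inv_def by (rule someI_ex) (use assms in blast)
  then show ?thesis
    using assms by (metis matrix_mul_assoc matrix_mul_lid matrix_mul_rid)
qed

lemma det_scaleR: "det (c *\<^sub>R (A :: complex ^ 'n::finite ^ 'n)) = of_real c ^ CARD('n) * det A"
proof -
  have "c *\<^sub>R A = (\<chi> i. of_real c *s A $ i)"
    by (simp add: vec_eq_iff) (simp add: scaleR_conv_of_real)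
  then show ?thesis
    using det_rows_mul[of "\<lambda>_. of_real c" "\<lambda>i. A $ i"] by simp
qed

text \<open>Each wedge is a number minus its conjugate, and the prefactor turns that difference into
  the imaginary part.\<close>

lemma kahler_form_eq_Im: "kahler_form v w = of_real (Im (\<Sum>n\<in>UNIV. v $ n * cnj (w $ n)))"
proof -
  have "(\<Sum>n\<in>UNIV. wedge2 (du n) (du_bar n) v w)
      = (\<Sum>n\<in>UNIV. v $ n * cnj (w $ n)) - cnj (\<Sum>n\<in>UNIV. v $ n * cnj (w $ n))"
    by (simp add: wedge2_def du_def du_bar_def sum_subtractf mult.commute)
  moreover have "1 / (2 * \<i>) * (z - cnj z) = of_real (Im z)" for z
    by (simp add: complex_eq_iff)
  ultimately show ?thesis
    by (simp only: kahler_form_def)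
qed

lemma holomorphic_volume_form_eq_det: "holomorphic_volume_form v = det (\<chi> n j. v j $ n)"
  by (simp add: holomorphic_volume_form_def wedge_def du_def det_def)

section \<open>Linear algebra at a single point, with \<open>B\<close> the inverse of
  \<open>M\<close>\<close>

context
  fixes M B :: "complex ^ 'n::finite ^ 'n"
  assumes MB: "M ** B = mat 1" and BM: "B ** M = mat 1"
begin

lemma tangent_vector_inverse:
  "M *v v \<in> imaginary_vecs \<longleftrightarrow> (\<exists>r. v = B *v (\<chi> m. \<i> * of_real (r m)))"
proof
  assume *: "M *v v \<in> imaginary_vecs"
  have "v = B *v (M *v v)"
    by (simp add: matrix_vector_mul_assoc BM)
  moreover have "M *v v = (\<chi> m. \<i> * of_real (Im ((M *v v) $ m)))"
    using * by (simp add: mem_imaginary_vecs vec_eq_iff complex_eq_iff)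
  ultimately show "\<exists>r. v = B *v (\<chi> m. \<i> * of_real (r m))"
    by metis
next
  assume "\<exists>r. v = B *v (\<chi> m. \<i> * of_real (r m))"
  then obtain r where "v = B *v (\<chi> m. \<i> * of_real (r m))" by blast
  then show "M *v v \<in> imaginary_vecs"
    by (simp add: matrix_vector_mul_assoc MB mem_imaginary_vecs)
qed

text \<open>The two imaginary units meet as \<i> times its conjugate, which is 1, so only the real
  parameters and the matrix remain.\<close>

lemma hermitian_product_tangent_vectors:
  fixes r s :: "'n \<Rightarrow> real"
  defines "v \<equiv> B *v (\<chi> m. \<i> * of_real (r m))" and "w \<equiv> B *v (\<chi> m. \<i> * of_real (s m))"
  shows "(\<Sum>n\<in>UNIV. v $ n * cnj (w $ n)) =
    (\<Sum>m\<in>UNIV. \<Sum>k\<in>UNIV. of_real (r m * s k) * (transpose B ** cnj_mat B) $ m $ k)"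
proof -
  have "(\<Sum>n\<in>UNIV. v $ n * cnj (w $ n)) =
      (\<Sum>n\<in>UNIV. \<Sum>m\<in>UNIV. \<Sum>k\<in>UNIV. of_real (r m * s k) * (B $ n $ m * cnj (B $ n $ k)))"
    by (simp add: v_def w_def matrix_vector_mult_def sum_product algebra_simps)
  also have "\<dots> = (\<Sum>m\<in>UNIV. \<Sum>n\<in>UNIV. \<Sum>k\<in>UNIV. of_real (r m * s k) * (B $ n $ m * cnj (B $ n $ k)))"
    by (rule sum.swap)
  also have "\<dots> = (\<Sum>m\<in>UNIV. \<Sum>k\<in>UNIV. \<Sum>n\<in>UNIV. of_real (r m * s k) * (B $ n $ m * cnj (B $ n $ k)))"
    by (intro sum.cong refl sum.swap)
  finally show ?thesis
    by (simp add: matrix_matrix_mult_def transpose_def cnj_mat_def sum_distrib_left)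
qed

lemma kahler_form_vanishes_iff:
  "(\<forall>v w. M *v v \<in> imaginary_vecs \<longrightarrow> M *v w \<in> imaginary_vecs \<longrightarrow> kahler_form v w = 0) \<longleftrightarrow>
    transpose (cnj_mat B ** M) = cnj_mat B ** M" (is "?lhs \<longleftrightarrow> ?rhs")
proof -
  let ?H = "transpose B ** cnj_mat B"
  have "?lhs \<longleftrightarrow> (\<forall>i j. Im (?H $ i $ j) = 0)"
  proof (intro iffI allI)
    fix i j assume ?lhs
    \<comment> \<open>The parameters are unit vectors, so the pair \<open>v i\<close>,
      \<open>v j\<close> singles out the entry of \<open>?H\<close> at \<open>i\<close>,
      \<open>j\<close>.\<close>
    define v where "v = (\<lambda>i. B *v (\<chi> m. \<i> * of_real (if m = i then 1 else 0)))"
    have "M *v v i \<in> imaginary_vecs" for i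
      unfolding tangent_vector_inverse v_def by (rule exI) (rule refl)
    with \<open>?lhs\<close> have "kahler_form (v i) (v j) = 0" by blast
    moreover have "(\<Sum>m\<in>UNIV. \<Sum>k\<in>UNIV.
        of_real ((if m = i then 1 else 0) * (if k = j then 1 else 0)) * ?H $ m $ k) = ?H $ i $ j"
    proof -
      have "(\<Sum>m\<in>UNIV. \<Sum>k\<in>UNIV.
          of_real ((if m = i then 1 else 0) * (if k = j then 1 else 0)) * ?H $ m $ k)
        = (\<Sum>m\<in>UNIV. \<Sum>k\<in>UNIV. if k = j then (if m = i then ?H $ m $ k else 0) else 0)"
        by (intro sum.cong refl) simp
      then show ?thesis by simp
    qed
    ultimately have "complex_of_real (Im (?H $ i $ j)) = 0"
      by (simp only: v_def kahler_form_eq_Im hermitian_product_tangent_vectors)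
    then show "Im (?H $ i $ j) = 0"
      by (simp only: of_real_eq_0_iff)
  next
    fix v w
    assume H: "\<forall>i j. Im (?H $ i $ j) = 0"
    show "M *v v \<in> imaginary_vecs \<longrightarrow> M *v w \<in> imaginary_vecs \<longrightarrow> kahler_form v w = 0"
    proof (intro impI)
      assume "M *v v \<in> imaginary_vecs" "M *v w \<in> imaginary_vecs"
      then obtain r s where v: "v = B *v (\<chi> m. \<i> * of_real (r m))" and w: "w = B *v (\<chi> m. \<i> * of_real (s m))"
        unfolding tangent_vector_inverse by blast
      show "kahler_form v w = 0"
        unfolding v w kahler_form_eq_Im hermitian_product_tangent_vectors using H by simp
    qed
  qed
  also have "\<dots> \<longleftrightarrow> cnj_mat ?H = ?H"
    by (rule cnj_mat_eq_self_iff[symmetric])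
  also have "\<dots> \<longleftrightarrow> ?rhs"
  proof -
    have BT: "transpose M ** transpose B = mat 1" "transpose B ** transpose M = mat 1"
      using MB BM by (metis matrix_transpose_mul transpose_mat)+
    have cH: "cnj_mat ?H = transpose (cnj_mat B) ** B"
      by (simp add: cnj_mat_mult cnj_mat_transpose)
    \<comment> \<open>Congruence by \<open>M\<close>, with plain transposes, sends \<open>?H\<close>
      to \<open>cnj_mat B ** M\<close> and \<open>cnj_mat ?H\<close> to the transpose of that
      matrix.\<close>
    have 1: "transpose M ** ?H ** M = cnj_mat B ** M"
      by (simp add: matrix_mul_assoc BT)
    have "transpose M ** cnj_mat ?H ** M = transpose M ** transpose (cnj_mat B) ** (B ** M)"
      by (simp only: cH matrix_mul_assoc)
    then have 2: "transpose M ** cnj_mat ?H ** M = transpose (cnj_mat B ** M)"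
      by (simp add: BM matrix_transpose_mul)
    \<comment> \<open>Congruence by \<open>B\<close> is the inverse operation, so no information is
      lost in passing to the congruent matrices.\<close>
    have 3: "transpose B ** (transpose M ** X ** M) ** B = X" for X
    proof -
      have "transpose B ** (transpose M ** X ** M) ** B = (transpose B ** transpose M) ** X ** (M ** B)"
        by (simp only: matrix_mul_assoc)
      then show ?thesis by (simp add: BT MB)
    qed
    show ?thesis
      using 1 2 3[of ?H] 3[of "cnj_mat ?H"] by metis
  qed
  finally show ?thesis .
qed

lemma Im_holomorphic_volume_form_vanishes_iff:
  "(\<forall>v. (\<forall>n. M *v v n \<in> imaginary_vecs) \<longrightarrow> Im (holomorphic_volume_form v) = 0) \<longleftrightarrow>
    det ((-1) ^ CARD('n) *\<^sub>R (cnj_mat B ** M)) = 1" (is "?lhs \<longleftrightarrow> ?rhs")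
proof -
  have vol: "holomorphic_volume_form (\<lambda>n. B *v (\<chi> m. \<i> * of_real (r n m)))
      = \<i> ^ CARD('n) * det B * of_real (det (\<chi> m n. r n m))" for r :: "'n \<Rightarrow> 'n \<Rightarrow> real"
  proof -
    let ?R = "(\<chi> m n. of_real (r n m)) :: complex ^ 'n ^ 'n"
    \<comment> \<open>The vectors are the columns of \<open>B\<close> times \<i> R; each of the d
      rows of \<i> R contributes one factor \<i> to the determinant.\<close>
    have "(\<chi> i j. (B *v (\<chi> m. \<i> * of_real (r j m))) $ i) = B ** (\<chi> m. \<i> *s ?R $ m)"
      by (simp add: vec_eq_iff matrix_vector_mult_def matrix_matrix_mult_def)
    moreover have "det (\<chi> m. \<i> *s ?R $ m) = \<i> ^ CARD('n) * det ?R"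
      using det_rows_mul[of "\<lambda>_. \<i>" "\<lambda>m. ?R $ m"] by simp
    moreover have "det ?R = of_real (det (\<chi> m n. r n m))"
      by (simp add: det_def)
    ultimately show ?thesis
      by (simp add: holomorphic_volume_form_eq_det det_mul)
  qed
  have "?lhs \<longleftrightarrow> Im (\<i> ^ CARD('n) * det B) = 0"
  proof
    assume ?lhs
    \<comment> \<open>The identity as real parameter matrix: its determinant 1 leaves exactly the
      factor to be tested.\<close>
    let ?r = "\<lambda>n m :: 'n. if m = n then 1 else 0 :: real"
    have *: "\<forall>n. M *v (B *v (\<chi> m. \<i> * of_real (?r n m))) \<in> imaginary_vecs"
      unfolding tangent_vector_inverse by (intro allI exI) (rule refl)
    have "Im (holomorphic_volume_form (\<lambda>n. B *v (\<chi> m. \<i> * of_real (?r n m)))) = 0"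
      using \<open>?lhs\<close>[THEN spec, THEN mp, OF *] .
    moreover have "(\<chi> m n. ?r n m) = mat 1"
      by (simp add: mat_def)
    ultimately show "Im (\<i> ^ CARD('n) * det B) = 0"
      by (simp only: vol det_I of_real_1 mult_1_right)
  next
    assume *: "Im (\<i> ^ CARD('n) * det B) = 0"
    show ?lhs
    proof (intro allI impI)
      fix v :: "'n \<Rightarrow> complex ^ 'n"
      assume "\<forall>n. M *v v n \<in> imaginary_vecs"
      then have "\<forall>n. \<exists>r. v n = B *v (\<chi> m. \<i> * of_real (r m))"
        unfolding tangent_vector_inverse .
      from choice[OF this] obtain r where "\<forall>n. v n = B *v (\<chi> m. \<i> * of_real (r n m))" ..
      then have v: "v = (\<lambda>n. B *v (\<chi> m. \<i> * of_real (r n m)))" by auto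
      have "Im (z * of_real x) = 0" if "Im z = 0" for z x
        using that by simp
      from this[OF *] show "Im (holomorphic_volume_form v) = 0"
        unfolding v vol .
    qed
  qed
  also have "\<dots> \<longleftrightarrow> \<i> ^ CARD('n) * det B = (- \<i>) ^ CARD('n) * cnj (det B)"
  proof -
    have "Im z = 0 \<longleftrightarrow> z = cnj z" for z
      by (auto simp: complex_eq_iff)
    then show ?thesis
      by (simp only: complex_cnj_mult complex_cnj_power complex_cnj_i)
  qed
  \<comment> \<open>The source of the sign in N: conjugating the d-th power of \<i> multiplies it by
    (-1)^d.\<close>
  also have "\<dots> \<longleftrightarrow> \<i> ^ CARD('n) * det B = \<i> ^ CARD('n) * ((-1) ^ CARD('n) * cnj (det B))"
    by (simp only: power_minus[of \<i>] mult_ac)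
  also have "\<dots> \<longleftrightarrow> det B = (-1) ^ CARD('n) * cnj (det B)"
    by (subst mult_cancel_left) simp
  also have "\<dots> \<longleftrightarrow> ?rhs"
  proof -
    have det_BM: "det B * det M = 1"
      by (simp only: det_mul[symmetric] BM det_I)
    then have "det M \<noteq> 0" by auto
    then have "det B = c \<longleftrightarrow> c * det M = 1" for c
      using mult_cancel_right[of "det B" "det M" c] by (auto simp: det_BM)
    \<comment> \<open>The scalar (-1)^d multiplies all d rows and enters the determinant as
      (-1)^(d*d); d*d and d have the same parity.\<close>
    moreover have "((-1) ^ CARD('n)) ^ CARD('n) = ((-1) ^ CARD('n) :: complex)"
      by (cases "even CARD('n)") simp_all
    ultimately show ?thesis
      by (simp add: det_scaleR det_mul det_cnj_mat mult.assoc)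
  qed
  finally show ?thesis .
qed

end

theorem mainTheorem1:
  fixes f :: "'n::finite \<Rightarrow> complex ^ 'n \<Rightarrow> real"
  assumes "\<And>m. smooth_on UNIV (f m)"
    and "\<And>x. x \<in> zero_locus f \<Longrightarrow> invertible (M_mat f x)"
  shows "supersymmetric (zero_locus f) \<longleftrightarrow>
    (\<forall>x\<in>zero_locus f. transpose (N_mat f x) = N_mat f x \<and> det (N_mat f x) = 1)"
proof -
  let ?T = "tangent_space (zero_locus f)"
  have "(\<forall>v\<in>?T p. \<forall>w\<in>?T p. kahler_form v w = 0) \<longleftrightarrow> transpose (N_mat f p) = N_mat f p" (is ?kahler)
    and "(\<forall>v. (\<forall>n. v n \<in> ?T p) \<longrightarrow> Im (holomorphic_volume_form v) = 0) \<longleftrightarrow> det (N_mat f p) = 1" (is ?vol)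
    if p: "p \<in> zero_locus f" for p
  proof -
    obtain B where B: "M_mat f p ** B = mat 1" "B ** M_mat f p = mat 1"
      using assms(2)[OF p] by (auto simp: invertible_def)
    then have "cnj_mat (M_mat f p) ** cnj_mat B = mat 1" "cnj_mat B ** cnj_mat (M_mat f p) = mat 1"
      by (metis cnj_mat_mult cnj_mat_one)+
    then have "matrix_inv (Mbar_mat f p) = cnj_mat B"
      unfolding Mbar_mat_eq_cnj_mat by (rule matrix_inv_unique)
    then have N: "N_mat f p = (-1) ^ CARD('n) *\<^sub>R (cnj_mat B ** M_mat f p)"
      by (simp only: N_mat_def)
    have T: "v \<in> ?T p \<longleftrightarrow> M_mat f p *v v \<in> imaginary_vecs" for v
      by (simp only: tangent_space_zero_locus[OF assms(1) p assms(2)[OF p]] mem_Collect_eq)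
    \<comment> \<open>The nonzero scalar (-1)^d comes out of the transpose and cancels on both
      sides.\<close>
    have "transpose (N_mat f p) = N_mat f p \<longleftrightarrow>
        transpose (cnj_mat B ** M_mat f p) = cnj_mat B ** M_mat f p"
      by (simp add: N transpose_scalar)
    also have "\<dots> \<longleftrightarrow> (\<forall>v\<in>?T p. \<forall>w\<in>?T p. kahler_form v w = 0)"
      unfolding kahler_form_vanishes_iff[OF B, symmetric] T[symmetric] by blast
    finally show ?kahler ..
    show ?vol
      unfolding T N by (rule Im_holomorphic_volume_form_vanishes_iff[OF B])
  qed
  \<comment> \<open>The submanifold clause is discharged from the hypotheses; the other two clauses
    match the two matrix conditions point by point.\<close>
  then show ?thesis
    unfolding supersymmetric_def
    by (simp add: embedded_submanifold_zero_locus[OF assms] ball_conj_distrib)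
qed

end
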